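(* Let $P,Q\in\mathbb{R}[x]$ be such that the product $R(x):=P(x)Q(x)$ has all of its coefficients in $\{0,1\}$ and $R(0)=1$. If $P(x)=x^5+ax^2+1$ for some real number $a$ with $0<a<1$, then $Q(x)$ has some (strictly) negative coefficient. *)

theory Defs
  imports Complex_Main "HOL-Computational_Algebra.Polynomial"
begin

end

theory Submission
  imports Defs "HOL-Computational_Algebra.Computational_Algebra"
begin

text \<open>
  Suppose that \<open>Q\<close> has no negative coefficient. The first coefficients of \<open>R\<close> are then forced, and
  \<open>R\<close> agrees with the power series of \<open>(1 + x^5) / (1 - x^2)\<close> below degree 21. The coefficients
  of \<open>Q\<close> are integer polynomials in \<open>a\<close>, monic up to sign in even degree, so \<open>a\<close> is a nonzero
  algebraic integer and has a complex conjugate \<open>b\<close> with \<open>|b| \<ge> 1\<close>, for which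
  \<open>x^5 + b x^2 + 1\<close> still divides \<open>R\<close>. This factor has a root \<open>z\<close> with \<open>|z| \<le> 8/9\<close>, and there
  \<open>R z = 0\<close> makes \<open>1 + z^5 = - b z^2\<close> as small as \<open>|z|^21 / (1 - |z|)\<close>, which is impossible.
\<close>

section \<open>A conjugate of modulus at least one\<close>

lemma map_poly_of_int_add:
  "map_poly (of_int :: int \<Rightarrow> 'a::comm_ring_1) (p + q) = map_poly of_int p + map_poly of_int q"
  by (rule poly_eqI) (simp add: coeff_map_poly)

lemma map_poly_of_int_diff:
  "map_poly (of_int :: int \<Rightarrow> 'a::comm_ring_1) (p - q) = map_poly of_int p - map_poly of_int q"
  by (rule poly_eqI) (simp add: coeff_map_poly)

lemma map_poly_of_int_mult:
  "map_poly (of_int :: int \<Rightarrow> 'a::comm_ring_1) (p * q) = map_poly of_int p * map_poly of_int q"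
  by (rule poly_eqI) (simp add: coeff_map_poly coeff_mult)

lemma map_poly_of_int_smult:
  "map_poly (of_int :: int \<Rightarrow> 'a::comm_ring_1) (smult c p) = smult (of_int c) (map_poly of_int p)"
  by (rule poly_eqI) (simp add: coeff_map_poly)

text \<open>With a leading coefficient of modulus one, the moduli of the roots multiply to the
  modulus of the constant coefficient, so they cannot all be below one.\<close>

lemma exists_root_norm_ge_1:
  fixes p :: "complex poly"
  assumes "norm (lead_coeff p) = 1" "norm (coeff p 0) \<ge> 1" "degree p > 0"
  obtains z where "poly p z = 0" "norm z \<ge> 1"
proof -
  obtain root where root: "smult (lead_coeff p) (\<Prod>i<degree p. [:-root i, 1:]) = p"
    by (rule complex_poly_decompose')
  have ev: "poly p z = lead_coeff p * (\<Prod>i<degree p. z - root i)" for z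
    by (subst root [symmetric]) (simp add: poly_prod)
  have z: "poly p (root i) = 0" if "i < degree p" for i
    using that by (auto simp: ev intro!: prod_zero)
  have "\<exists>i<degree p. norm (root i) \<ge> 1"
  proof (rule ccontr)
    assume "\<not> ?thesis"
    then have less: "norm (root i) < 1" if "i < degree p" for i
      using that by force
    have "norm (coeff p 0) = norm (poly p 0)"
      by (simp add: poly_0_coeff_0)
    also have "\<dots> = (\<Prod>i<degree p. norm (root i))"
      using assms(1) by (simp add: ev norm_mult prod_norm [symmetric])
    also have "\<dots> < (\<Prod>i<degree p. 1)"
      by (rule prod_mono_strict) (use less assms(3) in \<open>auto intro: less_imp_le\<close>)
    finally show False
      using assms(2) by simp
  qed
  then show thesis
    using that z by blast
qed

text \<open>The conjugate is a root of \<open>m\<close>, a primitive integer polynomial of least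
  degree vanishing at \<open>a\<close>. Up to sign \<open>m\<close> is monic, its constant
  coefficient is a nonzero integer, and it divides an integer multiple of every integer polynomial
  vanishing at \<open>a\<close>.\<close>

lemma algebraic_int_conjugate_norm_ge_1:
  fixes a :: real
  assumes "a \<noteq> 0" and h: "\<bar>lead_coeff h\<bar> = 1" "poly (map_poly of_int h) a = 0"
  obtains b :: complex where "norm b \<ge> 1"
    and "\<And>f. poly (map_poly of_int f) a = 0 \<Longrightarrow> poly (map_poly of_int f) b = 0"
proof -
  define V where "V = {f :: int poly. poly (map_poly of_int f) a = 0}"
  have "h \<noteq> 0"
    using h(1) by auto
  with h(2) have "\<exists>f. f \<in> V \<and> f \<noteq> 0"
    by (auto simp: V_def)
  then obtain m0 where m0: "m0 \<in> V" "m0 \<noteq> 0"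
    and min0: "\<And>f. f \<in> V \<Longrightarrow> f \<noteq> 0 \<Longrightarrow> degree m0 \<le> degree f"
    using ex_has_least_nat [of "\<lambda>f. f \<in> V \<and> f \<noteq> 0" _ degree] by blast
  define m where "m = primitive_part m0"
  have m0_eq: "m0 = smult (content m0) m"
    by (simp add: m_def)
  have "poly (map_poly of_int m0) a = of_int (content m0) * poly (map_poly of_int m) a"
    by (subst m0_eq) (simp add: map_poly_of_int_smult del: content_times_primitive_part)
  then have m: "m \<in> V" "m \<noteq> 0" "content m = 1" and deg: "degree m = degree m0"
    using m0 by (auto simp: V_def m_def)
  have min: "degree m \<le> degree f" if "f \<in> V" "f \<noteq> 0" for f
    using min0 [OF that] deg by simp
  \<comment> \<open>Pseudo-division stays within integer polynomials; the remainder vanishes at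
    \<open>a\<close>, so minimality of the degree makes it zero.\<close>
  have div: "\<exists>c g. c \<noteq> 0 \<and> smult c f = m * g" if f: "f \<in> V" for f
  proof -
    obtain c g where cg: "c \<noteq> 0" "smult c f = m * g + pseudo_mod f m"
      using pseudo_mod(1) [OF m(2)] by blast
    then have "pseudo_mod f m = smult c f - m * g"
      by simp
    then have "pseudo_mod f m \<in> V"
      using f m(1)
      by (simp add: V_def map_poly_of_int_diff map_poly_of_int_mult map_poly_of_int_smult)
    then have "pseudo_mod f m = 0"
      using min pseudo_mod(2) [OF m(2), of f] by force
    with cg show ?thesis
      by auto
  qed
  \<comment> \<open>Gauss's lemma: \<open>h\<close> and \<open>m\<close> have content 1, so
    \<open>g\<close> has content \<open>\<bar>c\<bar>\<close>, and this factor cancels when leading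
    coefficients are compared in \<open>smult c h = m * g\<close>.\<close>
  have "lead_coeff m dvd 1"
  proof -
    obtain c g where cg: "c \<noteq> 0" "smult c h = m * g"
      using div [of h] h(2) by (auto simp: V_def)
    have "content h dvd lead_coeff h"
      by (rule content_dvd_coeff)
    then have "content h dvd 1"
      using h(1) by (metis dvd_abs_iff)
    then have "normalize (content h) = 1"
      using is_unit_normalize by blast
    then have "content h = 1"
      by (simp only: normalize_content)
    have "normalize c * content h = content (m * g)"
      by (subst cg(2) [symmetric]) simp
    then have "content g = \<bar>c\<bar>"
      using \<open>content h = 1\<close> m(3) by (simp add: content_mult)
    have "c * lead_coeff h = lead_coeff m * lead_coeff g"
      using arg_cong [OF cg(2), of lead_coeff] cg(1) by (simp add: lead_coeff_mult)
    moreover obtain k where "lead_coeff g = \<bar>c\<bar> * k"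
      using content_dvd_coeff [of g "degree g"] \<open>content g = \<bar>c\<bar>\<close> by (metis dvdE)
    ultimately have "\<bar>c\<bar> * \<bar>lead_coeff h\<bar> = \<bar>c\<bar> * (\<bar>lead_coeff m\<bar> * \<bar>k\<bar>)"
      by (metis abs_mult abs_abs mult.left_commute)
    then have "1 = \<bar>lead_coeff m\<bar> * \<bar>k\<bar>"
      using cg(1) h(1) by simp
    then show ?thesis
      by (metis abs_dvd_iff dvd_triv_left)
  qed
  have "degree m > 0"
  proof (rule ccontr)
    assume "\<not> degree m > 0"
    then obtain c where "m = [:c:]"
      by (auto elim: degree_eq_zeroE)
    then show False
      using m(1,2) by (simp add: V_def map_poly_pCons)
  qed
  \<comment> \<open>Otherwise removing a factor of the variable, which is nonzero at
    \<open>a\<close>, gives an element of \<open>V\<close> of smaller degree.\<close>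
  have "coeff m 0 \<noteq> 0"
  proof
    assume 0: "coeff m 0 = 0"
    obtain c n where mn: "m = pCons c n"
      by (cases m)
    with 0 have c: "c = 0"
      by simp
    have "n \<in> V"
      using m(1) \<open>a \<noteq> 0\<close> by (auto simp: V_def mn c map_poly_pCons)
    moreover have "n \<noteq> 0"
      using m(2) by (auto simp: mn c)
    ultimately show False
      using min [of n] by (simp add: mn)
  qed
  define M where "M = (map_poly of_int m :: complex poly)"
  have degM: "degree M = degree m"
    by (simp add: M_def degree_map_poly)
  obtain b where b: "poly M b = 0" "norm b \<ge> 1"
  proof (rule exists_root_norm_ge_1 [of M])
    have "\<bar>lead_coeff m\<bar> = 1"
      using \<open>lead_coeff m dvd 1\<close> by simp
    then show "norm (lead_coeff M) = 1"
      unfolding degM by (simp add: M_def coeff_map_poly)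
    show "norm (coeff M 0) \<ge> 1"
      using \<open>coeff m 0 \<noteq> 0\<close> by (simp add: M_def coeff_map_poly)
    show "degree M > 0"
      using degM \<open>degree m > 0\<close> by simp
  qed
  show thesis
  proof
    show "norm b \<ge> 1"
      by (fact b)
    fix f :: "int poly"
    assume "poly (map_poly of_int f) a = 0"
    then obtain c g where cg: "c \<noteq> 0" "smult c f = m * g"
      using div [of f] by (auto simp: V_def)
    have "of_int c * poly (map_poly of_int f) b = poly (map_poly of_int (smult c f)) b"
      by (simp add: map_poly_of_int_smult)
    also have "\<dots> = 0"
      unfolding cg(2) using b(1) by (simp add: map_poly_of_int_mult M_def)
    finally show "poly (map_poly of_int f) b = 0"
      using cg(1) by simp
  qed
qed

section \<open>Coefficients of the cofactor\<close>

text \<open>The coefficients of the power series with coefficients \<open>r\<close> divided by \<open>1 + y x^2 + x^5\<close>.\<close>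

fun quot_coeff :: "(nat \<Rightarrow> 'a) \<Rightarrow> 'a \<Rightarrow> nat \<Rightarrow> 'a::comm_ring_1" where
  "quot_coeff r y n =
     r n - (if n < 2 then 0 else y * quot_coeff r y (n - 2)) -
     (if n < 5 then 0 else quot_coeff r y (n - 5))"

declare quot_coeff.simps [simp del]

lemma coeff_pentanomial_mult:
  fixes q :: "'a::comm_ring_1 poly"
  shows "coeff ((monom 1 5 + monom y 2 + 1) * q) n =
    coeff q n + (if n < 2 then 0 else y * coeff q (n - 2)) +
    (if n < 5 then 0 else coeff q (n - 5))"
  by (simp only: distrib_right coeff_add mult_1_left) (simp add: coeff_monom_mult not_less)

lemma coeff_eq_quot_coeff:
  "coeff q n = quot_coeff (coeff ((monom 1 5 + monom y 2 + 1) * q)) y n"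
proof (induction n rule: less_induct)
  case (less n)
  show ?case
    by (subst quot_coeff.simps, subst coeff_pentanomial_mult)
       (use less.IH [of "n - 2"] less.IH [of "n - 5"] in auto)
qed

text \<open>The power series quotient always exists because the constant term is 1; if it breaks off
  after index \<open>d\<close>, it is a polynomial cofactor.\<close>

lemma pentanomial_dvd:
  fixes p :: "'a::comm_ring_1 poly"
  assumes "\<And>n. n > d \<Longrightarrow> quot_coeff (coeff p) y n = 0"
  shows "(monom 1 5 + monom y 2 + 1) dvd p"
proof -
  define q where "q = (\<Sum>i\<le>d. monom (quot_coeff (coeff p) y i) i)"
  have q: "coeff q n = quot_coeff (coeff p) y n" for n
    using assms [of n] by (simp add: q_def coeff_sum)
  have "p = (monom 1 5 + monom y 2 + 1) * q"
  proof (rule poly_eqI)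
    fix n
    show "coeff p n = coeff ((monom 1 5 + monom y 2 + 1) * q) n"
      unfolding coeff_pentanomial_mult q by (subst (1) quot_coeff.simps) simp
  qed
  then show ?thesis
    by simp
qed

text \<open>The middle coefficient \<open>y\<close> becomes the variable of an integer polynomial. A
  coefficient of the cofactor that is zero at \<open>y = a\<close> is then an integer relation for
  \<open>a\<close>, which carries over to its conjugate.\<close>

definition quot_poly :: "(nat \<Rightarrow> int) \<Rightarrow> nat \<Rightarrow> int poly" where
  "quot_poly r = quot_coeff (\<lambda>n. [:r n:]) [:0, 1:]"

lemma poly_quot_poly:
  fixes y :: "'a::comm_ring_1"
  shows "poly (map_poly of_int (quot_poly r n)) y = quot_coeff (\<lambda>n. of_int (r n)) y n"
proof (induction n rule: less_induct)
  case (less n)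
  have "poly (map_poly of_int (quot_poly r n)) y = of_int (r n) -
     (if n < 2 then 0 else y * poly (map_poly of_int (quot_poly r (n - 2))) y) -
     (if n < 5 then 0 else poly (map_poly of_int (quot_poly r (n - 5))) y)"
    unfolding quot_poly_def
    by (subst quot_coeff.simps)
       (simp add: map_poly_of_int_diff map_poly_of_int_mult map_poly_pCons)
  also have "\<dots> = quot_coeff (\<lambda>n. of_int (r n)) y n"
    by (subst quot_coeff.simps) (use less.IH [of "n - 2"] less.IH [of "n - 5"] in auto)
  finally show ?case .
qed

lemma quot_poly_rec:
  "quot_poly r n = [:r n:] - (if n < 2 then 0 else pCons 0 (quot_poly r (n - 2))) -
     (if n < 5 then 0 else quot_poly r (n - 5))"
  unfolding quot_poly_def by (subst quot_coeff.simps) simp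

text \<open>In the recursion each factor of the variable uses up two units of the index, so the
  degree is at most half the index.\<close>

lemma coeff_quot_poly_eq_0: "n < 2 * k \<Longrightarrow> coeff (quot_poly r n) k = 0"
proof (induction n arbitrary: k rule: less_induct)
  case (less n)
  then obtain j where k: "k = Suc j"
    by (cases k) auto
  show ?case
    by (subst quot_poly_rec) (use less k in auto)
qed

text \<open>The power \<open>k\<close> arises only by stepping down by two all the way to index 0,
  with one sign per step; the branch that steps by five has too small a degree.\<close>

lemma coeff_quot_poly_even: "coeff (quot_poly r (2 * k)) k = (- 1) ^ k * r 0"
proof (induction k)
  case 0
  show ?case
    by (subst quot_poly_rec) simp
next
  case (Suc k)
  show ?case
    by (subst quot_poly_rec) (use Suc coeff_quot_poly_eq_0 [of "2 * k - 3" "Suc k"] in auto)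
qed

lemma lead_coeff_quot_poly_even:
  assumes "\<bar>r 0\<bar> = 1"
  shows "\<bar>lead_coeff (quot_poly r (2 * k))\<bar> = 1"
proof -
  have "degree (quot_poly r (2 * k)) = k"
  proof (rule antisym)
    show "degree (quot_poly r (2 * k)) \<le> k"
      by (rule degree_le) (auto intro: coeff_quot_poly_eq_0)
    show "k \<le> degree (quot_poly r (2 * k))"
      by (rule le_degree) (use assms in \<open>auto simp: coeff_quot_poly_even\<close>)
  qed
  then show ?thesis
    using assms by (simp add: coeff_quot_poly_even abs_mult)
qed

section \<open>A small root\<close>

lemma power_sum_large_imp_large:
  fixes w :: "'i \<Rightarrow> complex"
  assumes "finite I" "norm (\<Sum>i\<in>I. w i ^ n) > of_nat (card I) * c ^ n" "c \<ge> 0"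
  obtains i where "i \<in> I" "norm (w i) > c"
proof -
  have "\<exists>i\<in>I. norm (w i) > c"
  proof (rule ccontr)
    assume "\<not> ?thesis"
    then have "norm (w i ^ n) \<le> c ^ n" if "i \<in> I" for i
      using that assms(3) by (auto simp: norm_power intro!: power_mono)
    then have "norm (\<Sum>i\<in>I. w i ^ n) \<le> of_nat (card I) * c ^ n"
      by (intro sum_norm_bound)
    with assms(2) show False
      by simp
  qed
  then show thesis
    using that by blast
qed

text \<open>Newton's identities, where \<open>e1\<close> to \<open>e4\<close> are the elementary
  symmetric functions of the five roots.\<close>

lemma power_sums_quintic:
  fixes v w x y z b :: "'a::idom"
  assumes "[:-v, 1:] * ([:-w, 1:] * ([:-x, 1:] * ([:-y, 1:] * [:-z, 1:]))) = [:1, 0, 0, b, 0, 1:]"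
  shows "v + w + x + y + z = 0" "v\<^sup>2 + w\<^sup>2 + x\<^sup>2 + y\<^sup>2 + z\<^sup>2 = - 2 * b"
    "v ^ 3 + w ^ 3 + x ^ 3 + y ^ 3 + z ^ 3 = 0"
    "v ^ 4 + w ^ 4 + x ^ 4 + y ^ 4 + z ^ 4 = 2 * b\<^sup>2"
proof -
  define e1 where "e1 = v + w + x + y + z"
  define e2 where "e2 = v * w + (v + w) * x + (v + w + x) * y + (v + w + x + y) * z"
  define e3 where "e3 = v * w * x + (v * w + (v + w) * x) * y +
    (v * w + (v + w) * x + (v + w + x) * y) * z"
  define e4 where "e4 = v * w * x * y + (v * w * x + (v * w + (v + w) * x) * y) * z"
  note defs = e1_def e2_def e3_def e4_def
  have "[:-v, 1:] * ([:-w, 1:] * ([:-x, 1:] * ([:-y, 1:] * [:-z, 1:]))) =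
      [:- (v * w * x * y * z), e4, - e3, e2, - e1, 1:]"
    by (simp add: defs algebra_simps)
  from trans [OF this [symmetric] assms] have e: "e4 = 0" "e3 = 0" "e2 = b" "e1 = 0"
    by simp_all
  then show "v + w + x + y + z = 0"
    by (simp add: e1_def)
  have "v\<^sup>2 + w\<^sup>2 + x\<^sup>2 + y\<^sup>2 + z\<^sup>2 = e1\<^sup>2 - 2 * e2"
    unfolding defs by algebra
  then show "v\<^sup>2 + w\<^sup>2 + x\<^sup>2 + y\<^sup>2 + z\<^sup>2 = - 2 * b"
    by (simp add: e)
  have "v ^ 3 + w ^ 3 + x ^ 3 + y ^ 3 + z ^ 3 = e1 ^ 3 - 3 * e1 * e2 + 3 * e3"
    unfolding defs by algebra
  then show "v ^ 3 + w ^ 3 + x ^ 3 + y ^ 3 + z ^ 3 = 0"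
    by (simp add: e)
  have "v ^ 4 + w ^ 4 + x ^ 4 + y ^ 4 + z ^ 4 =
      e1 ^ 4 - 4 * e1\<^sup>2 * e2 + 2 * e2\<^sup>2 + 4 * e1 * e3 - 4 * e4"
    unfolding defs by algebra
  then show "v ^ 4 + w ^ 4 + x ^ 4 + y ^ 4 + z ^ 4 = 2 * b\<^sup>2"
    by (simp add: e)
qed

text \<open>If all five roots had modulus at most 9/8, every power sum \<open>s n\<close> would have
  modulus at most \<open>5 * (9 / 8) ^ n\<close>. The recurrence for \<open>s\<close> gives explicit
  polynomials in \<open>b\<close>, one of which violates this bound.\<close>

lemma reciprocal_pentanomial_large_root:
  fixes b :: complex
  assumes "norm b \<ge> 1"
  obtains w where "w ^ 5 + b * w ^ 3 + 1 = 0" "norm w > 9 / 8"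
proof -
  define p where "p = [:1, 0, 0, b, 0, 1:]"
  have "degree p = 5"
    by (simp add: p_def)
  obtain w where "smult (lead_coeff p) (\<Prod>i<degree p. [:-w i, 1:]) = p"
    by (rule complex_poly_decompose')
  then have fac: "(\<Prod>i<5. [:-w i, 1:]) = [:1, 0, 0, b, 0, 1:]"
    unfolding \<open>degree p = 5\<close> by (simp add: p_def eval_nat_numeral del: prod.lessThan_Suc)
  have root: "w i ^ 5 + b * w i ^ 3 + 1 = 0" if "i < 5" for i
  proof -
    have "poly (\<Prod>i<5. [:-w i, 1:]) (w i) = 0"
      using that by (auto simp: poly_prod intro!: prod_zero)
    then show ?thesis
      unfolding fac by (simp add: algebra_simps eval_nat_numeral)
  qed
  define s where "s n = (\<Sum>i<5. w i ^ n)" for n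
  have rec: "s (n + 5) = - b * s (n + 3) - s n" for n
  proof -
    have "w i ^ (n + 5) = - b * w i ^ (n + 3) - w i ^ n" if "i < 5" for i
    proof -
      have "w i ^ (n + 5) - (- b * w i ^ (n + 3) - w i ^ n) =
          w i ^ n * (w i ^ 5 + b * w i ^ 3 + 1)"
        by (simp add: power_add algebra_simps)
      also have "\<dots> = 0"
        by (simp only: root [OF that] mult_zero_right)
      finally show ?thesis
        by (rule eq_iff_diff_eq_0 [THEN iffD2])
    qed
    then have "s (n + 5) = (\<Sum>i<5. - b * w i ^ (n + 3) - w i ^ n)"
      unfolding s_def by (intro sum.cong) auto
    also have "\<dots> = - b * s (n + 3) - s n"
      unfolding s_def by (simp add: sum_subtractf sum_distrib_left sum_negf)
    finally show ?thesis .
  qed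
  have five: "{..<5::nat} = {0, 1, 2, 3, 4}"
    by auto
  have prod: "(\<Prod>i<5. [:-w i, 1:]) =
      [:-w 0, 1:] * ([:-w 1, 1:] * ([:-w 2, 1:] * ([:-w 3, 1:] * [:-w 4, 1:])))"
    unfolding five by (simp del: mult_pCons_left mult_pCons_right)
  have s0: "s 0 = 5"
    by (simp add: s_def)
  have s1: "s 1 = 0" and s2: "s 2 = - 2 * b" and s3: "s 3 = 0" and s4: "s 4 = 2 * b\<^sup>2"
    using power_sums_quintic [OF trans [OF prod [symmetric] fac]]
    unfolding s_def five by (simp_all add: add.assoc)
  have s5: "s 5 = - 5"
    using rec [of 0] s3 s0 by simp
  have s6: "s 6 = - 2 * b ^ 3"
    using rec [of 1, simplified] s4 s1 [simplified] by algebra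
  have s7: "s 7 = 7 * b"
    using rec [of 2, simplified] s5 s2 by algebra
  have s8: "s 8 = 2 * b ^ 4"
    using rec [of 3, simplified] s6 s3 by algebra
  have s9: "s 9 = - 9 * b ^ 2"
    using rec [of 4, simplified] s7 s4 by algebra
  have s10: "s 10 = 5 - 2 * b ^ 5"
    using rec [of 5, simplified] s8 s5 by algebra
  have s11: "s 11 = 11 * b ^ 3"
    using rec [of 6, simplified] s9 s6 by algebra
  have s12: "s 12 = 2 * b ^ 6 - 12 * b"
    using rec [of 7, simplified] s10 s7 by algebra
  have s13: "s 13 = - 13 * b ^ 4"
    using rec [of 8, simplified] s11 s8 by algebra
  have s14: "s 14 = 21 * b ^ 2 - 2 * b ^ 7"
    using rec [of 9, simplified] s12 s9 by algebra
  have s16: "s 16 = 2 * b ^ 8 - 32 * b ^ 3"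
    using rec [of 11, simplified] s14 s11 by algebra
  have s18: "s 18 = 45 * b ^ 4 - 2 * b ^ 9"
    using rec [of 13, simplified] s16 s13 by algebra
  \<comment> \<open>The power sums of order 11 and 18 are the ones with no cancellation for large \<open>|b|\<close> and for
    \<open>|b|\<close> near 1, respectively.\<close>
  have "\<exists>n. norm (s n) > 5 * (9 / 8) ^ n"
  proof (cases "norm b \<le> 5 / 4")
    case True
    define x where "x = norm b"
    have x: "1 \<le> x" "x \<le> 5 / 4"
      using assms True by (simp_all add: x_def)
    \<comment> \<open>The aim is \<open>45 * x ^ 4 - 2 * x ^ 9 \<ge> 43\<close>, where 43 is the
      value at \<open>x = 1\<close> and exceeds \<open>5 * (9 / 8) ^ 18\<close>, about 41.7. In
      terms of \<open>x ^ 4 - 1\<close> the gain has factor 43 and the loss has factor at most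
      45/4.\<close>
    have t: "x - 1 \<le> x ^ 4 - 1"
      using power_increasing [of 1 4 x] x by simp
    have "x * (x ^ 4 - 1) \<le> 5 / 4 * (x ^ 4 - 1)"
      using x t by (intro mult_right_mono) auto
    moreover have "x ^ 5 - 1 = x * (x ^ 4 - 1) + (x - 1)"
      by (simp add: algebra_simps eval_nat_numeral)
    ultimately have u: "x ^ 5 - 1 \<le> 9 / 4 * (x ^ 4 - 1)"
      using t by simp
    have "x ^ 4 \<le> (5 / 4) ^ 4"
      using x by (intro power_mono) auto
    then have "x ^ 4 \<le> 5 / 2"
      by (simp add: eval_nat_numeral)
    then have "x ^ 4 * (x ^ 5 - 1) \<le> 5 / 2 * (9 / 4 * (x ^ 4 - 1))"
      using u x by (intro mult_mono) auto
    moreover have "45 * x ^ 4 - 2 * x ^ 9 = 43 + 43 * (x ^ 4 - 1) - 2 * (x ^ 4 * (x ^ 5 - 1))"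
      by (simp add: algebra_simps flip: power_add)
    ultimately have "43 \<le> 45 * x ^ 4 - 2 * x ^ 9"
      using t x by simp
    also have "\<dots> = norm (45 * b ^ 4) - norm (2 * b ^ 9)"
      by (simp add: norm_mult norm_power x_def)
    also have "\<dots> \<le> norm (s 18)"
      unfolding s18 by (rule norm_triangle_ineq2)
    finally have "norm (s 18) > 5 * (9 / 8) ^ 18"
      by (simp add: eval_nat_numeral)
    then show ?thesis ..
  next
    case False
    have "11 * (5 / 4) ^ 3 \<le> 11 * norm b ^ 3"
      using False by (intro mult_left_mono power_mono) auto
    also have "\<dots> = norm (s 11)"
      by (simp add: s11 norm_mult norm_power)
    finally have "norm (s 11) > 5 * (9 / 8) ^ 11"
      by (simp add: eval_nat_numeral)
    then show ?thesis ..
  qed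
  then obtain n where n: "norm (s n) > 5 * (9 / 8) ^ n" ..
  obtain i where "i \<in> {..<5}" "norm (w i) > 9 / 8"
    by (rule power_sum_large_imp_large [of "{..<5}" "9 / 8" n w]) (use n in \<open>auto simp: s_def\<close>)
  then show thesis
    using root [of i] that by blast
qed

text \<open>Inverting a root of the reversed polynomial turns the lower bound 9/8 into the upper
  bound 8/9.\<close>

lemma pentanomial_small_root:
  fixes b :: complex
  assumes "norm b \<ge> 1"
  obtains z where "z ^ 5 + b * z\<^sup>2 + 1 = 0" "norm z < 8 / 9" "z \<noteq> 0"
proof -
  obtain w where w: "w ^ 5 + b * w ^ 3 + 1 = 0" "norm w > 9 / 8"
    using reciprocal_pentanomial_large_root [OF assms] .
  have "w \<noteq> 0"
    using w(2) by auto
  show thesis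
  proof
    have "inverse w ^ 5 + b * (inverse w)\<^sup>2 + 1 = (w ^ 5 + b * w ^ 3 + 1) / w ^ 5"
      using \<open>w \<noteq> 0\<close> by (simp add: field_simps eval_nat_numeral)
    then show "inverse w ^ 5 + b * (inverse w)\<^sup>2 + 1 = 0"
      by (simp add: w(1))
    have "inverse (norm w) < inverse (9 / 8)"
      using w(2) by (intro less_imp_inverse_less) auto
    then show "norm (inverse w) < 8 / 9"
      by (simp add: norm_inverse)
    show "inverse w \<noteq> 0"
      using \<open>w \<noteq> 0\<close> by simp
  qed
qed

section \<open>Size of the polynomial near its leading pattern\<close>

text \<open>
  Comparing the tail coefficients with 1/2 rather than with 1 improves the error factor from
  \<open>(1 + |z|^2) / (1 - |z|)\<close> to \<open>1 / (1 - |z|)\<close>, and then degree 21 suffices in the theorem.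
\<close>

lemma zero_one_poly_root_bound:
  fixes p :: "complex poly" and z :: complex
  assumes coeffs: "\<And>n. coeff p n \<in> {0, 1}"
    and p13: "coeff p 1 = 0" "coeff p 3 = 0"
    and p1: "\<And>n. n < 21 \<Longrightarrow> n \<noteq> 1 \<Longrightarrow> n \<noteq> 3 \<Longrightarrow> coeff p n = 1"
    and z: "poly p z = 0" "norm z < 1"
  shows "norm (1 + z ^ 5) \<le> norm z ^ 21 / (1 - norm z)"
proof -
  define t where "t = norm z"
  have t: "0 \<le> t" "t < 1"
    using z(2) by (simp_all add: t_def)
  have z1: "z \<noteq> 1"
    using z(2) by auto
  have p0: "(\<lambda>n. coeff p n * z ^ n) sums 0"
    using sums_finite [of "{..degree p}" "\<lambda>n. coeff p n * z ^ n"] z(1)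
    by (simp add: poly_altdef coeff_eq_0)
  have "(\<lambda>n. coeff p (n + 21) * z ^ (n + 21)) sums (0 - (\<Sum>n<21. coeff p n * z ^ n))"
    using p0 by (rule sums_split_initial_segment)
  moreover have "(\<Sum>n<21. coeff p n * z ^ n) = (\<Sum>n<21. z ^ n) - z - z ^ 3"
  proof -
    have "(\<Sum>n<21. coeff p n * z ^ n) =
        (\<Sum>n<21. z ^ n - (if n = 1 then z else 0) - (if n = 3 then z ^ 3 else 0))"
      using p13 p1 by (intro sum.cong) auto
    then show ?thesis
      by (simp add: sum_subtractf)
  qed
  ultimately have tail:
    "(\<lambda>n. z ^ 21 * (coeff p (n + 21) * z ^ n)) sums (z + z ^ 3 - (\<Sum>n<21. z ^ n))"
    by (simp add: power_add algebra_simps)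
  \<comment> \<open>Subtracting the tail from half a geometric series leaves coefficients
    \<open>1 / 2 - coeff p (n + 21)\<close>, all of modulus exactly 1/2.\<close>
  have "(\<lambda>n. z ^ 21 / 2 * z ^ n) sums (z ^ 21 / 2 * (1 / (1 - z)))"
    using z(2) by (intro sums_mult geometric_sums)
  from sums_diff [OF this tail]
  have "(\<lambda>n. z ^ 21 * (1 / 2 - coeff p (n + 21)) * z ^ n) sums
      (z ^ 21 / 2 * (1 / (1 - z)) - (z + z ^ 3 - (\<Sum>n<21. z ^ n)))"
    by (simp add: algebra_simps)
  moreover have "(\<Sum>n<21. z ^ n) = (1 - z ^ 21) / (1 - z)"
    using z1 by (simp add: sum_gp_strict)
  moreover have "z ^ 21 / 2 * (1 / (1 - z)) - (z + z ^ 3 - (1 - z ^ 21) / (1 - z)) =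
      (1 / (1 - z) - z - z ^ 3) - z ^ 21 / (2 * (1 - z))"
    using z1 by (simp add: field_simps)
  ultimately have sums: "(\<lambda>n. z ^ 21 * (1 / 2 - coeff p (n + 21)) * z ^ n) sums
      ((1 / (1 - z) - z - z ^ 3) - z ^ 21 / (2 * (1 - z)))"
    by (simp only:)
  have "(\<lambda>n. t ^ 21 / 2 * t ^ n) sums (t ^ 21 / 2 * (1 / (1 - t)))"
    using t by (intro sums_mult geometric_sums) auto
  with sums have "norm ((1 / (1 - z) - z - z ^ 3) - z ^ 21 / (2 * (1 - z))) \<le>
      t ^ 21 / 2 * (1 / (1 - t))"
  proof (rule norm_sums_le)
    fix n
    have half: "norm (1 / 2 - coeff p (n + 21)) = 1 / 2"
      using coeffs [of "n + 21"] by auto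
    then show "norm (z ^ 21 * (1 / 2 - coeff p (n + 21)) * z ^ n) \<le> t ^ 21 / 2 * t ^ n"
      unfolding norm_mult norm_power half t_def by simp
  qed
  \<comment> \<open>The factor \<open>1 - z\<^sup>2\<close> clears the leading pattern: it turns
    \<open>1 / (1 - z) - z - z ^ 3\<close> into \<open>1 + z ^ 5\<close>.\<close>
  then have "norm (1 - z\<^sup>2) * norm ((1 / (1 - z) - z - z ^ 3) - z ^ 21 / (2 * (1 - z))) \<le>
      (1 + t\<^sup>2) * (t ^ 21 / 2 * (1 / (1 - t)))"
    using norm_triangle_ineq4 [of 1 "z\<^sup>2"]
    by (intro mult_mono) (auto simp: t_def norm_power)
  moreover have "(1 - z\<^sup>2) * ((1 / (1 - z) - z - z ^ 3) - z ^ 21 / (2 * (1 - z))) =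
      (1 + z ^ 5) - z ^ 21 * (1 + z) / 2"
    using z1 by (simp add: divide_simps) algebra
  ultimately have *: "norm ((1 + z ^ 5) - z ^ 21 * (1 + z) / 2) \<le>
      (1 + t\<^sup>2) * (t ^ 21 / 2 * (1 / (1 - t)))"
    by (metis norm_mult)
  have bound: "norm (z ^ 21 * (1 + z) / 2) \<le> t ^ 21 * (1 + t) / 2"
    using norm_triangle_ineq [of 1 z]
    by (auto simp: norm_mult norm_divide norm_power t_def intro!: mult_left_mono)
  have eq: "(1 + t\<^sup>2) * (u / 2 * (1 / (1 - t))) + u * (1 + t) / 2 = u / (1 - t)" for u
    using t by (simp add: field_simps power2_eq_square)
  from * bound have "norm (1 + z ^ 5) \<le>
      (1 + t\<^sup>2) * (t ^ 21 / 2 * (1 / (1 - t))) + t ^ 21 * (1 + t) / 2"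
    using norm_triangle_sub [of "1 + z ^ 5" "z ^ 21 * (1 + z) / 2"] by simp
  also have "\<dots> = t ^ 21 / (1 - t)"
    by (rule eq)
  finally show ?thesis
    by (simp add: t_def)
qed

section \<open>The forced initial coefficients\<close>

text \<open>A positive contribution to \<open>r n\<close> forces \<open>r n = 1\<close>, which in
  turn determines \<open>q n\<close> by recursion. The even-indexed \<open>q\<close> stay positive
  up to index 18, and this fixes \<open>r\<close> below 21.\<close>

lemma forced_coeffs:
  fixes q r :: "nat \<Rightarrow> real" and a :: real
  assumes r: "\<And>n. r n = q n + (if n < 2 then 0 else a * q (n - 2)) +
      (if n < 5 then 0 else q (n - 5))"
    and r01: "\<And>n. r n \<in> {0, 1}" and r0: "r 0 = 1"
    and q: "\<And>n. q n \<ge> 0" and a: "0 < a" "a < 1"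
  shows "r 1 = 0" "r 3 = 0" "\<And>n. n < 21 \<Longrightarrow> n \<noteq> 1 \<Longrightarrow> n \<noteq> 3 \<Longrightarrow> r n = 1"
proof -
  have aq: "a * q n \<ge> 0" for n
    using a q by simp
  have aq_le: "a * q n \<le> a" if "q n \<le> 1" for n
    using a that mult_left_mono [of "q n" 1 a] by simp
  have aq_less: "a * q n < a" if "q n < 1" for n
    using a that by simp
  have aq_pos: "a * q n > 0" if "q n > 0" for n
    using a that by simp
  have q_le: "q n \<le> 1" for n
    using r [of n] r01 [of n] aq [of "n - 2"] q [of "n - 5"] by (auto split: if_splits)
  have r1I: "r n = 1" if "q (n - 2) > 0 \<or> q (n - 5) > 0" "n \<ge> 5" for n
    using that r [of n] r01 [of n] q [of n] q [of "n - 2"] q [of "n - 5"] aq [of "n - 2"]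
      aq_pos [of "n - 2"] by force
  have rec: "q n = 1 - a * q (n - 2) - q (n - 5)" if "q (n - 2) > 0 \<or> q (n - 5) > 0" "n \<ge> 5" for n
    using r1I [OF that] r [of n] that(2) by simp
  have q0: "q 0 = 1"
    using r [of 0] r0 by simp
  have r2: "r 2 = 1"
    using r [of 2] r01 [of 2] q0 q [of 2] a by auto
  have q2: "q 2 = 1 - a"
    using r [of 2] r2 q0 by simp
  have r5: "r 5 = 1"
    using q0 by (intro r1I) auto
  \<comment> \<open>The term \<open>q 0 = 1\<close> already accounts for all of \<open>r 5\<close>,
    so the other nonnegative terms vanish.\<close>
  have "q 5 + a * q 3 = 0"
    using r [of 5] r5 q0 by simp
  then have q5: "q 5 = 0" and q3: "q 3 = 0"
    using q [of 5] aq [of 3] a by (auto simp: add_nonneg_eq_0_iff)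
  \<comment> \<open>With \<open>q 3 = 0\<close>, the values \<open>r 1 = q 1\<close> and
    \<open>r 3 = a * q 1\<close> both lie in {0, 1}; \<open>q 1 = 1\<close> would give
    \<open>r 3 = a\<close>, strictly between.\<close>
  have q1: "q 1 = 0"
    using r [of 1] r [of 3] r01 [of 1] r01 [of 3] q3 a by auto
  show r1: "r 1 = 0" and r3: "r 3 = 0"
    using r [of 1] r [of 3] q1 q3 by simp_all
  have "a * q 2 > 0"
    using q2 a by (intro aq_pos) simp
  then have r4: "r 4 = 1"
    using r [of 4] r01 [of 4] q [of 4] by auto
  have q4: "q 4 = 1 - a * q 2"
    using r [of 4] r4 by simp
  have q4_pos: "q 4 > 0"
    using q4 aq_le [OF q_le, of 2] a by linarith
  have q6: "q 6 = 1 - a * q 4"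
    using rec [of 6] q4_pos q1 by simp
  have q6_pos: "q 6 > 0"
    using q6 aq_le [OF q_le, of 4] a by linarith
  have q7: "q 7 = a"
    using rec [of 7] q2 q5 a by simp
  have q8: "q 8 = 1 - a * q 6"
    using rec [of 8] q6_pos q3 by simp
  have q8_pos: "q 8 > 0"
    using q8 aq_le [OF q_le, of 6] a by linarith
  have q9: "q 9 = a * (1 - 2 * a)"
    using rec [of 9] q4_pos q7 q4 q2 by (simp add: algebra_simps)
  \<comment> \<open>Nonnegativity of \<open>q 9\<close> is what restricts \<open>a\<close> to at
    most 1/2; the positivity arguments from index 12 on rely on it.\<close>
  then have a2: "a \<le> 1 / 2"
    using q [of 9] a by (simp add: zero_le_mult_iff)
  have q9_le: "q 9 \<le> a"
    using a by (simp add: q9 mult_left_le)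
  have q10: "q 10 = 1 - a * q 8"
    using rec [of 10] q8_pos q5 by simp
  have q10_pos: "q 10 > 0"
    using q10 aq_le [OF q_le, of 8] a by linarith
  have q11_le: "q 11 \<le> a"
    using rec [of 11, simplified] q6_pos q6 aq_le [OF q_le, of 4] aq [of 9] by linarith
  have q12: "q 12 = 1 - a * q 10 - a"
    using rec [of 12] q10_pos q7 by simp
  \<comment> \<open>From here on, an even-indexed \<open>q n\<close> loses less than
    \<open>a\<close> through \<open>a * q (n - 2)\<close>, since \<open>q (n - 2) < 1\<close>, and
    at most \<open>a\<close> through \<open>q (n - 5)\<close>. It thus exceeds
    \<open>1 - 2 * a \<ge> 0\<close>; the strict inequality covers \<open>a = 1 / 2\<close>.\<close>
  have q12_pos: "q 12 > 0"
    using q12 q10 aq_pos [OF q8_pos] aq_less [of 10] a2 by linarith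
  have q12_less: "q 12 < 1"
    using q12 aq [of 10] a by linarith
  have q13_le: "q 13 \<le> a"
    using rec [of 13, simplified] q8_pos q8 aq_le [OF q_le, of 6] aq [of 11] by linarith
  have q14: "q 14 = 1 - a * q 12 - q 9"
    using rec [of 14] q12_pos by simp
  have q14_pos: "q 14 > 0"
    using q14 aq_less [OF q12_less] q9_le a2 by linarith
  have q14_less: "q 14 < 1"
    using q14 aq_pos [OF q12_pos] q [of 9] by linarith
  have q16: "q 16 = 1 - a * q 14 - q 11"
    using rec [of 16] q14_pos by simp
  have q16_pos: "q 16 > 0"
    using q16 aq_less [OF q14_less] q11_le a2 by linarith
  have q16_less: "q 16 < 1"
    using q16 aq_pos [OF q14_pos] q [of 11] by linarith
  have q18_pos: "q 18 > 0"
    using rec [of 18, simplified] q16_pos aq_less [OF q16_less] q13_le a2 by linarith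
  show "r n = 1" if n: "n < 21" "n \<noteq> 1" "n \<noteq> 3" for n
  proof (cases "n < 5")
    case True
    then have "n \<in> {0, 2, 4}"
      using n by auto
    then show ?thesis
      using r0 r2 r4 by auto
  next
    case False
    have "\<forall>j<10. q (2 * j) > 0"
      using q0 q2 a q4_pos q6_pos q8_pos q10_pos q12_pos q14_pos q16_pos q18_pos
      by (simp add: eval_nat_numeral All_less_Suc)
    then have pos: "q k > 0" if "even k" "k < 20" for k
      using that by (auto elim!: evenE)
    \<comment> \<open>For even \<open>n\<close> the step by two reaches an even index, for odd
      \<open>n\<close> the step by five does; the largest index needed is 18, for
      \<open>n = 20\<close>.\<close>
    have "even (n - 2) \<and> n - 2 < 20 \<or> even (n - 5) \<and> n - 5 < 20"
      using n False by auto
    then have "q (n - 2) > 0 \<or> q (n - 5) > 0"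
      using pos by blast
    then show ?thesis
      using False by (intro r1I) auto
  qed
qed

section \<open>Transfer of the factorisation to the conjugate, and the final size estimate\<close>

theorem theorem1p5:
  fixes P Q R :: "real poly" and a :: real
  assumes "R = P * Q"
    and "\<And>n. coeff R n \<in> {0, 1}"
    and "poly R 0 = 1"
    and "P = monom 1 5 + monom a 2 + 1"
    and "0 < a" and "a < 1"
  shows "\<exists>n. coeff Q n < 0"
proof (rule ccontr)
  assume "\<not> ?thesis"
  then have Q: "coeff Q n \<ge> 0" for n
    by (simp add: not_less)
  have R: "R = (monom 1 5 + monom a 2 + 1) * Q"
    using assms by simp
  have R0: "coeff R 0 = 1"
    using assms(3) by (simp add: poly_0_coeff_0)
  note forced = forced_coeffs [of "coeff R" "coeff Q",
      OF coeff_pentanomial_mult [of a Q, folded R] assms(2) R0 Q assms(5,6)]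
  define r where "r n = \<lfloor>coeff R n\<rfloor>" for n
  have r: "coeff R = (\<lambda>n. of_int (r n))"
  proof
    fix n
    show "coeff R n = of_int (r n)"
      using assms(2) [of n] by (auto simp: r_def)
  qed
  have quot: "poly (map_poly of_int (quot_poly r n)) a = coeff Q n" for n
    by (simp add: poly_quot_poly coeff_eq_quot_coeff [of Q n a] r flip: R)
  define d where "d = degree Q"
  \<comment> \<open>The index \<open>2 * Suc d\<close> is even and beyond the degree of
    \<open>Q\<close>, so this polynomial is monic up to sign and vanishes at
    \<open>a\<close>.\<close>
  have lead: "\<bar>lead_coeff (quot_poly r (2 * Suc d))\<bar> = 1"
    using R0 by (intro lead_coeff_quot_poly_even) (simp add: r_def)
  have "poly (map_poly of_int (quot_poly r (2 * Suc d))) a = 0"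
    unfolding quot by (simp add: coeff_eq_0 d_def)
  from algebraic_int_conjugate_norm_ge_1 [OF _ lead this] assms(5)
  obtain b :: complex where b: "norm b \<ge> 1" and
    conj: "\<And>f. poly (map_poly of_int f) a = 0 \<Longrightarrow> poly (map_poly of_int f) b = 0"
    by auto
  define S where "S = (map_poly of_real R :: complex poly)"
  have S: "coeff S n = of_real (coeff R n)" for n
    by (simp add: S_def coeff_map_poly)
  \<comment> \<open>The vanishing of each cofactor coefficient past \<open>d\<close> is an integer
    relation for \<open>a\<close>, hence holds for \<open>b\<close> as well.\<close>
  have "(monom 1 5 + monom b 2 + 1) dvd S"
  proof (rule pentanomial_dvd)
    fix n
    assume "d < n"
    then have "poly (map_poly of_int (quot_poly r n)) b = 0"
      by (intro conj) (simp add: quot coeff_eq_0 d_def)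
    moreover have "coeff S = (\<lambda>n. of_int (r n))"
      by (rule ext) (simp add: S r)
    ultimately show "quot_coeff (coeff S) b n = 0"
      by (simp add: poly_quot_poly)
  qed
  then obtain T where T: "S = (monom 1 5 + monom b 2 + 1) * T"
    by (elim dvdE)
  obtain z where z: "z ^ 5 + b * z\<^sup>2 + 1 = 0" "norm z < 8 / 9" "z \<noteq> 0"
    using pentanomial_small_root [OF b] .
  define t where "t = norm z"
  have t: "0 < t" "t < 8 / 9"
    using z by (simp_all add: t_def)
  have "poly S z = 0"
    using z(1) by (simp add: T poly_monom)
  then have "norm (1 + z ^ 5) \<le> t ^ 21 / (1 - t)"
    unfolding t_def
    by (rule zero_one_poly_root_bound [rotated 4])
       (use assms(2) forced z(2) in \<open>auto simp: S\<close>)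
  also have "1 + z ^ 5 = - (b * z\<^sup>2)"
    using z(1) by (simp add: eq_neg_iff_add_eq_0 algebra_simps)
  finally have "norm b * t\<^sup>2 \<le> t ^ 21 / (1 - t)"
    by (simp add: norm_mult norm_power t_def)
  moreover have "1 * t\<^sup>2 \<le> norm b * t\<^sup>2"
    using b by (intro mult_right_mono) auto
  ultimately have "t\<^sup>2 \<le> t ^ 21 / (1 - t)"
    by simp
  also have "\<dots> = t\<^sup>2 * (t ^ 19 / (1 - t))"
    by (simp flip: power_add)
  finally have "t\<^sup>2 * 1 \<le> t\<^sup>2 * (t ^ 19 / (1 - t))"
    by (simp only: mult_1_right)
  then have "1 \<le> t ^ 19 / (1 - t)"
    by (rule mult_left_le_imp_le) (use t in simp)
  \<comment> \<open>The bound is increasing in \<open>t\<close>; at \<open>t = 8 / 9\<close> it is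
    about 0.96.\<close>
  also have "\<dots> \<le> (8 / 9) ^ 19 / (1 / 9)"
    using t by (intro frac_le power_mono) auto
  also have "\<dots> < 1"
    by (simp add: eval_nat_numeral)
  finally show False
    by simp
qed

end
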